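(* Let $\beta\in\{1,2,4,8\}$, let $\mathfrak{A}$ be the real normed division algebra of real dimension $\beta$, and let $n\ge m\ge 1$ be integers. Let $\nu,k\in\mathbb{R}$ with $\nu\beta/2>-k$, and let $\tau=(t_1,\dots,t_m)\in\mathbb{R}^m$ with $n\beta/2>(m-1)\beta/2-t_m$. Let $S_1=(S_1^{1/2})^2\sim\mathcal{R}_1^{\beta,I}(\nu\beta/2,k,1)$ be independent of $\mathbf{Y}\sim\mathcal{KR}_{n\times m}^{\beta,I}(\tau,\mathbf{0},\mathbf{I}_n,\mathbf{I}_m)$. Define $\mathbf{R}=S^{-1/2}\mathbf{Y}$, where $S=S_1+\|\mathbf{Y}\|^2$. Then $S\sim\mathcal{R}_1^{\beta,I}\bigl((\nu+mn)\beta/2+\sum_{i=1}^m t_i,\,k,\,1\bigr)$, and $S$ is independent of $\mathbf{R}$. Furthermore, the density of $\mathbf{R}$ with respect to $(d\mathbf{R})$ is $$\frac{\Gamma_m^\beta[n\beta/2]\;\Gamma_1^\beta\left[(\nu+mn)\beta/2+k+\sum_{i=1}^m t_i\right]}{\pi^{\beta mn/2}\;\Gamma_m^\beta[n\beta/2,\tau]\;\Gamma_1^\beta[\nu\beta/2+k]}\left(1-\|\mathbf{R}\|^2\right)^{\nu\beta/2+k-1}q_\tau(\mathbf{R}^*\mathbf{R}),$$ where $1-\|\mathbf{R}\|^2>0$. This law is termed the standardised matrix multivariate Pearson type II-Riesz type distribution and is denoted $\mathbf{R}\sim\mathcal{P}_{II}\mathcal{R}_{n\times m}^{\beta,I}(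\nu,k,\tau,1,\mathbf{0},\mathbf{I}_n,\mathbf{I}_m)$.
   Context: $\mathfrak{A}$ is $\mathbb{R}$ ($\beta=1$), $\mathbb{C}$ ($\beta=2$), the quaternions ($\beta=4$) or the octonions ($\beta=8$). $\mathfrak{A}^{n\times m}$ is the space of $n\times m$ matrices over $\mathfrak{A}$, of real dimension $\beta mn$, and $(d\mathbf{X})$ is Lebesgue measure on it. $\mathfrak{L}_{n,m}^\beta$ is the set of $n\times m$ matrices over $\mathfrak{A}$ of rank $m\le n$ with $m$ distinct positive singular values. $\mathbf{X}^*$ is the conjugate transpose and $\|\mathbf{X}\|=\sqrt{\operatorname{tr}\mathbf{X}^*\mathbf{X}}$. $|\cdot|$ denotes the determinant. For Hermitian $\mathbf{A}\in\mathfrak{A}^{m\times m}$ with leading principal $p\times p$ submatrices $\mathbf{A}_p$, and $\tau=(t_1,\dots,t_m)\in\mathbb{R}^m$, $$q_\tau(\mathbf{A})=|\mathbf{A}_m|^{t_m}\prod_{i=1}^{m-1}|\mathbf{A}_i|^{t_i-t_{i+1}}.$$ $\Gamma_m^\beta[a,\tau]=\pi^{m(m-1)\beta/4}\prod_{i=1}^m\Gamma\bigl(a+t_i-(i-1)\beta/2\bigr)$ and $\Gamma_m^\beta[a]=\Gamma_m^\beta[a,(0,\dots,0)]$, where $\Gamma$ is the usual gamma function; in particular $\Gamma_1^\beta[a]=\Gamma(a)$. $V\sim\mathcal{R}_1^{\beta,I}(a,k,1)$ (one-dimensional Riesz distribution of type I) means that $V$ is a positive random variable with density $\dfrac{\beta^{a+k}}{\Gamma(a+k)}e^{-\beta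 v}v^{a+k-1}$, $v>0$. $\mathbf{Y}\sim\mathcal{KR}_{n\times m}^{\beta,I}(\tau,\mathbf{0},\mathbf{I}_n,\mathbf{I}_m)$ (Kotz-Riesz distribution of type I) means that $\mathbf{Y}\in\mathfrak{L}_{n,m}^\beta$ is a random matrix with density, with respect to $(d\mathbf{Y})$, $$\frac{\beta^{mn\beta/2+\sum_{i=1}^m t_i}\,\Gamma_m^\beta[n\beta/2]}{\pi^{mn\beta/2}\,\Gamma_m^\beta[n\beta/2,\tau]}\exp\{-\beta\operatorname{tr}\mathbf{Y}^*\mathbf{Y}\}\,q_\tau(\mathbf{Y}^*\mathbf{Y}).$$ *)

theory Defs
  imports "HOL-Probability.Probability" "HOL-Combinatorics.Cycles"
begin

section \<open>Real normed division algebras\<close>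

text \<open>Finite-dimensional, unital, not necessarily associative, with a multiplicative Euclidean norm.
  By Hurwitz' theorem the members of this class are, up to isometric isomorphism, exactly the reals,
  the complex numbers, the quaternions and the octonions; all four are instances (see below).\<close>

class normed_division_algebra = euclidean_space + times + one +
  assumes nda_distrib_left: "x * (y + z) = x * y + x * z"
    and nda_distrib_right: "(x + y) * z = x * z + y * z"
    and nda_scaleR_left: "(r *\<^sub>R x) * y = r *\<^sub>R (x * y)"
    and nda_scaleR_right: "x * (r *\<^sub>R y) = r *\<^sub>R (x * y)"
    and nda_one_left: "1 * x = x"
    and nda_one_right: "x * 1 = x"
    and nda_norm_mult: "norm (x * y) = norm x * norm y"

class assoc_normed_division_algebra = normed_division_algebra +
  assumes nda_assoc: "(x * y) * z = x * (y * z)"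

class comm_normed_division_algebra = assoc_normed_division_algebra +
  assumes nda_comm: "x * y = y * x"

text \<open>The real part; the copy of the reals inside the algebra is the line spanned by 1.\<close>

definition re_part :: "'a::{real_inner,one} \<Rightarrow> real"
  where "re_part x = x \<bullet> 1"

text \<open>Conjugation fixes the real line and negates its orthogonal complement.\<close>

definition nda_conj :: "'a::{real_inner,one} \<Rightarrow> 'a"
  where "nda_conj x = (2 * re_part x) *\<^sub>R 1 - x"

instance real :: comm_normed_division_algebra
  by standard (auto simp: algebra_simps abs_mult)

instance complex :: comm_normed_division_algebra
  by standard (auto simp: algebra_simps norm_mult)

lemma nda_conj_real [simp]: "nda_conj (x::real) = x"
  by (simp add: nda_conj_def re_part_def)

lemma nda_conj_complex [simp]: "nda_conj (z::complex) = cnj z"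
  by (simp add: nda_conj_def re_part_def inner_complex_def complex_eq_iff)

lemma nda_norm_one: "norm (1::'a::normed_division_algebra) = 1"
proof -
  obtain b :: 'a where "b \<in> Basis" using nonempty_Basis by blast
  then have "norm b = 1" by simp
  with nda_norm_mult[of b 1] show ?thesis by (simp add: nda_one_right)
qed

lemma nda_diff_left: "(x - y) * z = x * z - y * (z::'a::normed_division_algebra)"
  by (metis add_diff_cancel diff_add_cancel nda_distrib_right)

lemma nda_diff_right: "z * (x - y) = z * x - z * (y::'a::normed_division_algebra)"
  by (metis add_diff_cancel diff_add_cancel nda_distrib_left)

lemma nda_inner_mult: "(x * y) \<bullet> (x * y) = (x \<bullet> x) * (y \<bullet> (y::'a::normed_division_algebra))"
  by (metis dot_square_norm nda_norm_mult power_mult_distrib)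

lemma nda_inner_mult_left: "(x * y) \<bullet> (x * z) = (x \<bullet> x) * (y \<bullet> (z::'a::normed_division_algebra))"
  using nda_inner_mult[of x "y + z"] nda_inner_mult[of x y] nda_inner_mult[of x z]
  by (simp add: nda_distrib_left inner_add_left inner_add_right inner_commute algebra_simps)

lemma nda_inner_mult_right: "(y * x) \<bullet> (z * x) = (x \<bullet> x) * (y \<bullet> (z::'a::normed_division_algebra))"
  using nda_inner_mult[of "y + z" x] nda_inner_mult[of y x] nda_inner_mult[of z x]
  by (simp add: nda_distrib_right inner_add_left inner_add_right inner_commute algebra_simps)

lemma nda_inner_mult_both:
  "(x * y) \<bullet> (w * z) + (w * y) \<bullet> (x * z) = 2 * (x \<bullet> w) * (y \<bullet> (z::'a::normed_division_algebra))"
  using nda_inner_mult_left[of "x + w" y z] nda_inner_mult_left[of x y z] nda_inner_mult_left[of w y z]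
  by (simp add: nda_distrib_right inner_add_left inner_add_right inner_commute algebra_simps)

lemma nda_adjoint_left: "(x * y) \<bullet> z = y \<bullet> (nda_conj x * (z::'a::normed_division_algebra))"
  using nda_inner_mult_both[of x y 1 z]
  by (simp add: nda_conj_def re_part_def nda_one_left nda_diff_left nda_scaleR_left inner_diff_right)

lemma nda_adjoint_right: "(x * y) \<bullet> z = x \<bullet> (z * nda_conj (y::'a::normed_division_algebra))"
  using nda_inner_mult_both[of x y z 1]
  by (simp add: nda_conj_def re_part_def nda_one_right nda_diff_right nda_scaleR_right
      inner_diff_right inner_commute algebra_simps)

lemma nda_conj_conj [simp]: "nda_conj (nda_conj x) = (x::'a::normed_division_algebra)"
proof -
  have "(1::'a) \<bullet> 1 = 1" using nda_norm_one[where 'a='a] by (simp add: norm_eq_1)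
  then show ?thesis by (simp add: nda_conj_def re_part_def inner_diff_left algebra_simps)
qed

lemma nda_conj_add: "nda_conj (x + y) = nda_conj x + nda_conj (y::'a::normed_division_algebra)"
  by (simp add: nda_conj_def re_part_def inner_add_left algebra_simps)

lemma nda_conj_diff: "nda_conj (x - y) = nda_conj x - nda_conj (y::'a::normed_division_algebra)"
  by (simp add: nda_conj_def re_part_def inner_diff_left algebra_simps)

lemma nda_conj_scaleR: "nda_conj (r *\<^sub>R x) = r *\<^sub>R nda_conj (x::'a::normed_division_algebra)"
  by (simp add: nda_conj_def re_part_def algebra_simps)

lemma nda_conj_inner: "nda_conj x \<bullet> y = x \<bullet> nda_conj (y::'a::normed_division_algebra)"
  by (simp add: nda_conj_def re_part_def inner_diff_left inner_diff_right inner_commute)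

lemma nda_conj_mult: "nda_conj (x * y) = nda_conj y * nda_conj (x::'a::normed_division_algebra)"
proof -
  have "nda_conj (x * y) \<bullet> z = (nda_conj y * nda_conj x) \<bullet> z" for z
  proof -
    have "nda_conj (x * y) \<bullet> z = y \<bullet> (nda_conj x * nda_conj z)"
      by (simp add: nda_conj_inner nda_adjoint_left)
    also have "\<dots> = (nda_conj x * nda_conj z) \<bullet> y" by (rule inner_commute)
    also have "\<dots> = nda_conj x \<bullet> (y * z)" by (simp add: nda_adjoint_right)
    also have "\<dots> = (y * z) \<bullet> nda_conj x" by (rule inner_commute)
    also have "\<dots> = z \<bullet> (nda_conj y * nda_conj x)" by (rule nda_adjoint_left)
    also have "\<dots> = (nda_conj y * nda_conj x) \<bullet> z" by (rule inner_commute)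
    finally show ?thesis .
  qed
  then show ?thesis by (metis vector_eq_ldot inner_commute)
qed


subsection \<open>Quaternions and octonions by Cayley--Dickson doubling\<close>

datatype 'a cd = CD (cd1: 'a) (cd2: 'a)

lemma cd_eq_iff: "x = y \<longleftrightarrow> cd1 x = cd1 y \<and> cd2 x = cd2 y"
  by (cases x; cases y) simp

instantiation cd :: (euclidean_space) euclidean_space
begin
definition "0 = CD 0 0"
definition "x + y = CD (cd1 x + cd1 y) (cd2 x + cd2 y)"
definition "x - y = CD (cd1 x - cd1 y) (cd2 x - cd2 y)"
definition "- x = CD (- cd1 x) (- cd2 x)"
definition "r *\<^sub>R x = CD (r *\<^sub>R cd1 x) (r *\<^sub>R cd2 x)"
definition "x \<bullet> y = cd1 x \<bullet> cd1 y + cd2 x \<bullet> cd2 y"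
definition "norm (x::'a cd) = sqrt (x \<bullet> x)"
definition "dist (x::'a cd) y = norm (x - y)"
definition "sgn (x::'a cd) = inverse (norm x) *\<^sub>R x"
definition "(uniformity :: ('a cd \<times> 'a cd) filter) =
  (INF e\<in>{0 <..}. principal {(x, y). dist x y < e})"
definition "open (U :: 'a cd set) \<longleftrightarrow>
  (\<forall>x\<in>U. eventually (\<lambda>(x', y). x' = x \<longrightarrow> y \<in> U) uniformity)"
definition "(Basis :: 'a cd set) = (\<lambda>b. CD b 0) ` Basis \<union> (\<lambda>b. CD 0 b) ` Basis"

instance
proof
  fix x y z :: "'a cd" and r s :: real and U :: "'a cd set"
  note defs = zero_cd_def plus_cd_def minus_cd_def uminus_cd_def scaleR_cd_def inner_cd_def cd_eq_iff
  show "x + y + z = x + (y + z)" "x + y = y + x" "0 + x = x" "- x + x = 0" "x - y = x + - y"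
    "r *\<^sub>R (x + y) = r *\<^sub>R x + r *\<^sub>R y" "(r + s) *\<^sub>R x = r *\<^sub>R x + s *\<^sub>R x"
    "r *\<^sub>R s *\<^sub>R x = (r * s) *\<^sub>R x" "1 *\<^sub>R x = x"
    by (auto simp: defs algebra_simps)
  show "x \<bullet> y = y \<bullet> x" "(x + y) \<bullet> z = x \<bullet> z + y \<bullet> z" "(r *\<^sub>R x) \<bullet> y = r * (x \<bullet> y)" "0 \<le> x \<bullet> x"
    by (auto simp: defs inner_commute inner_add_left algebra_simps)
  show "(x \<bullet> x = 0) = (x = 0)"
    by (auto simp: defs add_nonneg_eq_0_iff)
  show "sgn x = inverse (norm x) *\<^sub>R x" "dist x y = norm (x - y)" "norm x = sqrt (x \<bullet> x)"
    "(uniformity :: ('a cd \<times> 'a cd) filter) = (INF e\<in>{0 <..}. principal {(x, y). dist x y < e})"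
    "open U \<longleftrightarrow> (\<forall>x\<in>U. eventually (\<lambda>(x', y). x' = x \<longrightarrow> y \<in> U) uniformity)"
    by (rule sgn_cd_def dist_cd_def norm_cd_def uniformity_cd_def open_cd_def)+
  show "(Basis :: 'a cd set) \<noteq> {}" "finite (Basis :: 'a cd set)"
    by (auto simp: Basis_cd_def)
  show "u \<bullet> v = (if u = v then 1 else 0)" if "u \<in> Basis" "v \<in> Basis" for u v :: "'a cd"
    using that by (auto simp: Basis_cd_def inner_cd_def inner_Basis split: if_splits)
  show "(\<forall>u\<in>Basis. x \<bullet> u = 0) = (x = 0)"
    by (auto simp: Basis_cd_def inner_cd_def zero_cd_def cd_eq_iff ball_Un euclidean_all_zero_iff)
qed
end

lemma DIM_cd [simp]: "DIM('a::euclidean_space cd) = 2 * DIM('a)"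
proof -
  have "(\<lambda>b::'a. CD b 0) ` Basis \<inter> (\<lambda>b. CD 0 b) ` Basis = {}" by auto
  then show ?thesis
    by (simp add: Basis_cd_def card_Un_disjoint card_image inj_on_def)
qed

instantiation cd :: (normed_division_algebra) "{times,one}"
begin
definition "1 = CD 1 0"
definition "x * y = CD (cd1 x * cd1 y - nda_conj (cd2 y) * cd2 x)
  (cd2 y * cd1 x + cd2 x * nda_conj (cd1 y))"
instance ..
end

lemma nda_zero_left [simp]: "0 * x = (0::'a::normed_division_algebra)"
  using nda_scaleR_left[of 0 0 x] by simp

lemma nda_zero_right [simp]: "x * 0 = (0::'a::normed_division_algebra)"
  using nda_scaleR_right[of x 0 0] by simp

lemma nda_conj_0 [simp]: "nda_conj 0 = (0::'a::normed_division_algebra)"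
  by (simp add: nda_conj_def re_part_def)

lemma nda_conj_1 [simp]: "nda_conj 1 = (1::'a::normed_division_algebra)"
proof -
  have "(1::'a) \<bullet> 1 = 1" using nda_norm_one[where 'a='a] by (simp add: norm_eq_1)
  then show ?thesis by (simp add: nda_conj_def re_part_def scaleR_2)
qed

lemma nda_norm_conj: "nda_conj x \<bullet> nda_conj x = x \<bullet> (x::'a::normed_division_algebra)"
  by (simp add: nda_conj_inner)

lemma nda_conj_cd: "nda_conj (x::'a::normed_division_algebra cd) = CD (nda_conj (cd1 x)) (- cd2 x)"
  by (simp add: nda_conj_def re_part_def inner_cd_def one_cd_def minus_cd_def scaleR_cd_def)

instance cd :: (assoc_normed_division_algebra) normed_division_algebra
proof
  fix x y z :: "'a cd" and r :: real
  note defs = zero_cd_def plus_cd_def minus_cd_def uminus_cd_def scaleR_cd_def one_cd_def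
    times_cd_def cd_eq_iff nda_conj_add nda_conj_scaleR nda_distrib_left nda_distrib_right
    nda_scaleR_left nda_scaleR_right nda_one_left nda_one_right
  show "x * (y + z) = x * y + x * z" "(x + y) * z = x * z + y * z"
    "(r *\<^sub>R x) * y = r *\<^sub>R (x * y)" "x * (r *\<^sub>R y) = r *\<^sub>R (x * y)" "1 * x = x" "x * 1 = x"
    by (auto simp: defs algebra_simps)
  obtain a b c d where x: "x = CD a b" and y: "y = CD c d" by (cases x; cases y)
  have cross: "(a * c) \<bullet> (nda_conj d * b) = (d * a) \<bullet> (b * nda_conj c)"
  proof -
    have "(a * c) \<bullet> (nda_conj d * b) = (d * (a * c)) \<bullet> b" by (simp add: nda_adjoint_left)
    also have "\<dots> = ((d * a) * c) \<bullet> b" by (simp add: nda_assoc)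
    also have "\<dots> = (d * a) \<bullet> (b * nda_conj c)" by (simp add: nda_adjoint_right)
    finally show ?thesis .
  qed
  have "(x * y) \<bullet> (x * y) = (x \<bullet> x) * (y \<bullet> y)"
    using cross
    by (simp add: x y times_cd_def inner_cd_def inner_add_left inner_add_right inner_diff_left
        inner_diff_right nda_inner_mult nda_norm_conj inner_commute algebra_simps)
  then show "norm (x * y) = norm x * norm y"
    by (simp add: norm_cd_def real_sqrt_mult)
qed

instance cd :: (comm_normed_division_algebra) assoc_normed_division_algebra
proof
  fix x y z :: "'a cd"
  have lc: "a * (b * c) = b * (a * c)" for a b c :: 'a
    by (metis nda_assoc nda_comm)
  show "(x * y) * z = x * (y * z)"
    by (simp add: times_cd_def nda_conj_add nda_conj_diff nda_conj_mult nda_distrib_left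
        nda_distrib_right nda_diff_left nda_diff_right nda_assoc nda_comm lc algebra_simps)
qed

type_synonym quaternion = "complex cd"
type_synonym octonion = "quaternion cd"

lemma DIM_quaternion: "DIM(quaternion) = 4" and DIM_octonion: "DIM(octonion) = 8"
  by simp_all


section \<open>Matrices over a normed division algebra\<close>

text \<open>An \<open>n \<times> m\<close> matrix has type \<open>'a^'m^'n\<close>. The library's matrix product and trace require
  an associative ring, which excludes the octonions.\<close>

definition mat_adj :: "'a::normed_division_algebra^'m^'n \<Rightarrow> 'a^'n^'m"
  where "mat_adj X = (\<chi> i j. nda_conj (X $ j $ i))"

definition mat_mul :: "'a::normed_division_algebra^'k^'n \<Rightarrow> 'a^'m^'k \<Rightarrow> 'a^'m^'n"
  where "mat_mul X Z = (\<chi> i j. \<Sum>k\<in>UNIV. X $ i $ k * Z $ k $ j)"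

definition mat_vec :: "'a::normed_division_algebra^'m^'n \<Rightarrow> 'a^'m \<Rightarrow> 'a^'n"
  where "mat_vec X v = (\<chi> i. \<Sum>j\<in>UNIV. X $ i $ j * v $ j)"

text \<open>The trace of a Hermitian matrix lies on the real line; the real part only makes it a
  \<open>real\<close>.\<close>

definition mat_tr :: "'a::normed_division_algebra^'m^'m \<Rightarrow> real"
  where "mat_tr A = re_part (\<Sum>i\<in>UNIV. A $ i $ i)"

definition mat_norm :: "'a::normed_division_algebra^'m^'n \<Rightarrow> real"
  where "mat_norm X = sqrt (mat_tr (mat_mul (mat_adj X) X))"

definition hermitian :: "'a::normed_division_algebra^'m^'m \<Rightarrow> bool"
  where "hermitian A \<longleftrightarrow> mat_adj A = A"

lemma mat_tr_adj_mul: "mat_tr (mat_mul (mat_adj X) X) = (norm X)\<^sup>2"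
proof -
  have *: "(nda_conj x * x) \<bullet> 1 = x \<bullet> x" for x :: 'a
    by (simp add: nda_adjoint_left nda_one_right)
  have "mat_tr (mat_mul (mat_adj X) X) = (\<Sum>i\<in>UNIV. \<Sum>k\<in>UNIV. X $ k $ i \<bullet> X $ k $ i)"
    by (simp add: mat_tr_def mat_mul_def mat_adj_def re_part_def inner_sum_left *)
  also have "\<dots> = X \<bullet> X"
    by (subst sum.swap) (simp add: inner_vec_def)
  finally show ?thesis by (simp add: dot_square_norm)
qed

lemma mat_norm_eq_norm: "mat_norm X = norm X"
  by (simp add: mat_norm_def mat_tr_adj_mul)


subsection \<open>Determinant\<close>

text \<open>Over a noncommutative algebra the determinant of a Hermitian matrix is Moore's: the Leibniz sum
  in which the factors \<open>a\<^bsub>i,\<sigma>(i)\<^esub>\<close> are multiplied cycle by cycle, every cycle starting at its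
  least index. For Hermitian matrices over the reals, the complex numbers and the quaternions this sum
  is real, and over the first two it is the ordinary determinant (see \<open>leading_det_eq_det_real\<close>
  and \<open>leading_det_eq_det_complex\<close>). Over the octonions products are bracketed to
  the left and the real part is taken; up to size 3 this is the Freudenthal determinant of the Jordan
  algebra of Hermitian matrices, beyond that there is no canonical notion.\<close>

definition cycle_word :: "('m::{finite,linorder} \<Rightarrow> 'm) \<Rightarrow> 'm set \<Rightarrow> 'm list"
  where "cycle_word \<sigma> J = concat (map (support \<sigma>)
    (filter (\<lambda>i. \<forall>j\<in>set (support \<sigma> i). i \<le> j) (sorted_list_of_set J)))"

definition moore_term ::
    "'a::normed_division_algebra^'m::{finite,linorder}^'m::{finite,linorder} \<Rightarrow> ('m \<Rightarrow> 'm) \<Rightarrow> 'm set \<Rightarrow> 'a"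
  where "moore_term A \<sigma> J = foldl (\<lambda>x i. x * A $ i $ \<sigma> i) 1 (cycle_word \<sigma> J)"

definition first_indices :: "nat \<Rightarrow> 'm::{finite,linorder} set"
  where "first_indices p = {j. card {l. l < j} < p}"

text \<open>\<open>leading_det p A\<close> is the determinant of the leading principal \<open>p \<times> p\<close>
  submatrix \<open>A\<^sub>p\<close>.\<close>

definition leading_det :: "nat \<Rightarrow> 'a::normed_division_algebra^'m::{finite,linorder}^'m::{finite,linorder} \<Rightarrow> real"
  where "leading_det p A = re_part (\<Sum>\<sigma> | \<sigma> permutes first_indices p.
    of_int (sign \<sigma>) *\<^sub>R moore_term A \<sigma> (first_indices p))"

lemma first_indices_full: "first_indices CARD('m) = (UNIV :: 'm::{finite,linorder} set)"
proof -
  have "card {l. l < j} < CARD('m)" for j :: 'm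
    by (rule psubset_card_mono) auto
  then show ?thesis by (auto simp: first_indices_def)
qed

lemma set_support_permutes:
  assumes "\<sigma> permutes J" "i \<in> J" "finite J"
  shows "set (support \<sigma> i) \<subseteq> J" "i \<in> set (support \<sigma> i)"
proof -
  have "(\<sigma> ^^ k) i \<in> J" for k
    by (induction k) (auto simp: assms(2) permutes_in_image[OF assms(1)])
  then show "set (support \<sigma> i) \<subseteq> J" by auto
  have "permutation \<sigma>" using assms permutation_permutes by blast
  then have "least_power \<sigma> i > 0" by (rule least_power_of_permutation)
  then show "i \<in> set (support \<sigma> i)" by (auto intro!: image_eqI[of _ _ 0])
qed

lemma cycle_word_permutes:
  assumes \<sigma>: "\<sigma> permutes (J::'m::{finite,linorder} set)"
  shows "distinct (cycle_word \<sigma> J)" "set (cycle_word \<sigma> J) = J"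
proof -
  have perm: "permutation \<sigma>" using \<sigma> permutation_permutes finite by blast
  have disj: "disjoint ((set \<circ> support \<sigma>) ` UNIV)"
    using disjoint_support[OF perm] by (simp add: comp_def full_SetCompr_eq)
  have self: "i \<in> set (support \<sigma> i)" for i
    by (rule set_support_permutes(2)[OF permutes_subset[OF \<sigma> subset_UNIV]]) auto
  define L where "L = filter (\<lambda>i. \<forall>j\<in>set (support \<sigma> i). i \<le> j) (sorted_list_of_set J)"
  have w: "cycle_word \<sigma> J = concat (map (support \<sigma>) L)" by (simp add: cycle_word_def L_def)
  have same: "set (support \<sigma> i) = set (support \<sigma> j)"
    if "k \<in> set (support \<sigma> i)" "k \<in> set (support \<sigma> j)" for i j k
    using disj that by (fastforce simp: disjoint_def)
  have dL: "distinct L" by (simp add: L_def)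
  have inj: "i = j" if "i \<in> set L" "j \<in> set L" "k \<in> set (support \<sigma> i)" "k \<in> set (support \<sigma> j)" for i j k
  proof (rule antisym)
    show "i \<le> j" using that(1) same[OF that(3,4)] self[of j] by (simp add: L_def del: set_map)
    show "j \<le> i" using that(2) same[OF that(3,4)] self[of i] by (simp add: L_def del: set_map)
  qed
  have "distinct (concat (map (support \<sigma>) M))" if "distinct M" "set M \<subseteq> set L" for M
    using that
  proof (induction M)
    case (Cons i M)
    have "distinct (support \<sigma> i)" using cycle_of_permutation[OF perm] .
    moreover have "set (support \<sigma> i) \<inter> set (support \<sigma> j) = {}" if "j \<in> set M" for j
    proof (rule ccontr)
      assume "set (support \<sigma> i) \<inter> set (support \<sigma> j) \<noteq> {}"
      then obtain k where "k \<in> set (support \<sigma> i)" "k \<in> set (support \<sigma> j)" by blast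
      then have "i = j" using inj Cons.prems that by (metis in_mono list.set_intros)
      then show False using Cons.prems that by auto
    qed
    then have "set (support \<sigma> i) \<inter> (\<Union>j\<in>set M. set (support \<sigma> j)) = {}" by blast
    ultimately show ?case using Cons by (simp add: image_image)
  qed simp
  then show "distinct (cycle_word \<sigma> J)" using dL w by auto
  have "i \<in> set (cycle_word \<sigma> J)" if "i \<in> J" for i
  proof -
    let ?S = "set (support \<sigma> i)"
    have S: "?S \<subseteq> J" "i \<in> ?S" using set_support_permutes[OF \<sigma> that] by auto
    define m where "m = Min ?S"
    have m: "m \<in> ?S" "\<And>j. j \<in> ?S \<Longrightarrow> m \<le> j"
      using S(2) by (auto simp: m_def simp del: set_map intro: Min_in)
    have eq: "set (support \<sigma> m) = ?S" using same[OF self m(1)] .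
    have "m \<in> set L" using m S eq by (auto simp: L_def simp del: set_map)
    then have "support \<sigma> m \<in> set (map (support \<sigma>) L)" by (subst set_map) (rule imageI)
    moreover have "i \<in> set (support \<sigma> m)" unfolding eq by (rule S(2))
    ultimately show ?thesis unfolding w set_concat by (rule UN_I)
  qed
  moreover have "set (cycle_word \<sigma> J) \<subseteq> J"
  proof -
    have "set L \<subseteq> J" by (auto simp: L_def)
    then have "set (support \<sigma> j) \<subseteq> J" if "j \<in> set L" for j
      using set_support_permutes(1)[OF \<sigma> _ finite] that by (metis subsetD)
    then have "(\<Union>j\<in>set L. set (support \<sigma> j)) \<subseteq> J" by (rule UN_least)
    then show ?thesis unfolding w set_concat set_map image_image .
  qed
  ultimately show "set (cycle_word \<sigma> J) = J" by blast
qed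

lemma moore_term_comm:
  fixes A :: "'a::{normed_division_algebra,comm_ring_1}^'m::{finite,linorder}^'m::{finite,linorder}"
  assumes "\<sigma> permutes J"
  shows "moore_term A \<sigma> J = (\<Prod>i\<in>J. A $ i $ \<sigma> i)"
proof -
  have "foldl (\<lambda>x i. x * f i) a xs = a * prod_list (map f xs)" for f and a :: 'a and xs :: "'m list"
    by (induction xs arbitrary: a) (auto simp: mult.assoc)
  then show ?thesis
    using cycle_word_permutes[OF assms]
      prod.distinct_set_conv_list[of "cycle_word \<sigma> J" "\<lambda>i. A $ i $ \<sigma> i"]
    by (simp add: moore_term_def)
qed

lemma leading_det_full_comm:
  fixes A :: "'a::{normed_division_algebra,comm_ring_1}^'m::{finite,linorder}^'m::{finite,linorder}"
  shows "leading_det CARD('m) A = re_part (det A)"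
proof -
  have "of_int (sign \<sigma>) *\<^sub>R x = of_int (sign \<sigma>) * x" for \<sigma> :: "'m \<Rightarrow> 'm" and x :: 'a
    by (cases \<sigma> rule: sign_cases) auto
  then show ?thesis
    by (simp add: leading_det_def first_indices_full det_def moore_term_comm)
qed

lemma leading_det_eq_det_real: "leading_det CARD('m) A = det (A :: real^'m::{finite,linorder}^'m::{finite,linorder})"
  by (simp add: leading_det_full_comm re_part_def)

lemma leading_det_eq_det_complex:
  fixes A :: "complex^'m::{finite,linorder}^'m::{finite,linorder}"
  assumes "hermitian A"
  shows "of_real (leading_det CARD('m) A) = det A"
proof -
  have "cnj (det A) = (\<Sum>p | p permutes (UNIV::'m set). of_int (sign p) * (\<Prod>i\<in>UNIV. cnj (A $ i $ p i)))"
    by (simp add: det_def)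
  also have "\<dots> = det (transpose (mat_adj A))"
    by (simp add: det_def mat_adj_def transpose_def)
  also have "\<dots> = det A" using assms by (simp add: det_transpose hermitian_def)
  finally have "Im (det A) = 0" by (simp add: complex_eq_iff)
  then show ?thesis
    by (simp add: leading_det_full_comm re_part_def inner_complex_def complex_eq_iff)
qed


subsection \<open>The generalised power and the set of full-rank matrices\<close>

text \<open>Throughout, \<open>\<tau> = (t\<^sub>1, \<dots>, t\<^sub>m)\<close> is a function on \<open>nat\<close> of which only the
  values at \<open>1, \<dots>, m\<close> are used. For \<open>A = X\<^sup>*X\<close> of full rank over an
  associative algebra the leading minors are positive. An octonionic \<open>X\<^sup>*X\<close> of size at
  least 3 may have negative ones, where \<open>powr\<close> acts on the absolute value.\<close>

definition q_power :: "(nat \<Rightarrow> real) \<Rightarrow> 'a::normed_division_algebra^'m::{finite,linorder}^'m::{finite,linorder} \<Rightarrow> real"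
  where "q_power t A = leading_det CARD('m) A powr t CARD('m) *
    (\<Prod>i = 1..CARD('m) - 1. leading_det i A powr (t i - t (i + 1)))"

text \<open>The singular values of \<open>X\<close> are the nonnegative square roots of the (real) eigenvalues of
  \<open>X\<^sup>*X\<close>.\<close>

definition singular_values :: "'a::normed_division_algebra^'m^'n \<Rightarrow> real set"
  where "singular_values X =
    {s. s \<ge> 0 \<and> (\<exists>v. v \<noteq> 0 \<and> mat_vec (mat_mul (mat_adj X) X) v = s\<^sup>2 *\<^sub>R v)}"

text \<open>Rank \<open>m\<close> means that the \<open>m\<close> columns are right linearly independent.\<close>

definition full_rank_distinct_sv :: "('a::normed_division_algebra^'m^'n) set"
  where "full_rank_distinct_sv = {X. (\<forall>v. mat_vec X v = 0 \<longrightarrow> v = 0) \<and>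
    (\<exists>D. D \<subseteq> singular_values X \<and> (\<forall>s\<in>D. s > 0) \<and> card D = CARD('m))}"


section \<open>Distributions\<close>

text \<open>The library's \<open>indep_var\<close> requires both random variables to have the same type;
  this is the same notion (independence of the generated \<open>\<sigma>\<close>-algebras) for two types.\<close>

definition indep_rv ::
    "'w measure \<Rightarrow> 'b measure \<Rightarrow> ('w \<Rightarrow> 'b) \<Rightarrow> 'c measure \<Rightarrow> ('w \<Rightarrow> 'c) \<Rightarrow> bool"
  where "indep_rv M N1 X1 N2 X2 \<longleftrightarrow>
    X1 \<in> measurable M N1 \<and> X2 \<in> measurable M N2 \<and>
    prob_space.indep_set M {X1 -` A \<inter> space M | A. A \<in> sets N1} {X2 -` B \<inter> space M | B. B \<in> sets N2}"

definition multi_gamma :: "real \<Rightarrow> nat \<Rightarrow> real \<Rightarrow> (nat \<Rightarrow> real) \<Rightarrow> real"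
  where "multi_gamma \<beta> m a t = pi powr (real m * (real m - 1) * \<beta> / 4) *
    (\<Prod>i = 1..m. Gamma (a + t i - (real i - 1) * \<beta> / 2))"

definition riesz1 :: "'w measure \<Rightarrow> real \<Rightarrow> real \<Rightarrow> real \<Rightarrow> ('w \<Rightarrow> real) \<Rightarrow> bool"
  where "riesz1 M \<beta> a k V \<longleftrightarrow> distributed M lborel V (\<lambda>v. ennreal
    (if v > 0 then \<beta> powr (a + k) / Gamma (a + k) * exp (- \<beta> * v) * v powr (a + k - 1) else 0))"

definition kotz_riesz_density ::
    "real \<Rightarrow> (nat \<Rightarrow> real) \<Rightarrow> 'a::normed_division_algebra^'m::{finite,linorder}^'n \<Rightarrow> real"
  where "kotz_riesz_density \<beta> t Y =
    (let n = real CARD('n); m = real CARD('m) in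
      \<beta> powr (m * n * \<beta> / 2 + (\<Sum>i = 1..CARD('m). t i)) * multi_gamma \<beta> CARD('m) (n * \<beta> / 2) (\<lambda>_. 0)
      / (pi powr (m * n * \<beta> / 2) * multi_gamma \<beta> CARD('m) (n * \<beta> / 2) t)
      * exp (- \<beta> * mat_tr (mat_mul (mat_adj Y) Y)) * q_power t (mat_mul (mat_adj Y) Y))"

text \<open>\<open>lborel\<close> on \<open>'a^'m^'n\<close> is Lebesgue measure in the \<open>\<beta>mn\<close> real coordinates of
  the matrix.\<close>

definition kotz_riesz ::
    "'w measure \<Rightarrow> real \<Rightarrow> (nat \<Rightarrow> real) \<Rightarrow>
     ('w \<Rightarrow> 'a::normed_division_algebra^'m::{finite,linorder}^'n) \<Rightarrow> bool"
  where "kotz_riesz M \<beta> t Y \<longleftrightarrow>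
    distributed M lborel Y (\<lambda>X. ennreal (kotz_riesz_density \<beta> t X)) \<and>
    (AE \<omega> in M. Y \<omega> \<in> full_rank_distinct_sv)"

end

theory Submission
  imports Defs
begin

text \<open>The function \<open>q\<^sub>\<tau>(X\<^sup>*X)\<close> is homogeneous of degree \<open>2 \<Sum> t\<^sub>i\<close> in \<open>X\<close>, and this is all that
  matters about it. In the joint law of \<open>(S\<^sub>1, Y)\<close> substitute \<open>S\<^sub>1 = s - \<parallel>Y\<parallel>\<^sup>2\<close> for fixed \<open>Y\<close>, exchange
  the integrals, and substitute \<open>Y = s\<^bsup>1/2\<^esup>R\<close> for fixed \<open>s\<close>: only a translation and a scaling of
  Lebesgue measure are needed. The exponentials combine to \<open>exp(-\<beta>s)\<close>, so the density splits
  into a gamma kernel in \<open>s\<close> and a Pearson kernel in \<open>R\<close>. This gives independence and both laws up to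
  constants, which are fixed by the total mass 1.\<close>

section \<open>Homogeneity of the leading minors and of the generalised power\<close>

text \<open>Counting the smaller elements maps the index type bijectively onto
  \<open>{..<CARD('m)}\<close>, and the first \<open>p\<close> indices are the preimage of
  \<open>{..<p}\<close>.\<close>

lemma card_first_indices:
  assumes "p \<le> CARD('m::{finite,linorder})"
  shows "card (first_indices p :: 'm set) = p"
proof -
  define r where "r = (\<lambda>j::'m. card {l. l < j})"
  have "strict_mono r"
    unfolding strict_mono_def r_def by (intro allI impI psubset_card_mono) auto
  then have inj: "inj r"
    by (rule strict_mono_imp_inj_on)
  have "r ` UNIV \<subseteq> {..<CARD('m)}"
    by (auto simp: r_def intro!: psubset_card_mono)
  moreover have "card (r ` UNIV) = card {..<CARD('m)}"
    by (simp add: card_image[OF inj])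
  ultimately have range: "range r = {..<CARD('m)}"
    by (intro card_subset_eq) auto
  have "(first_indices p :: 'm set) = r -` {..<p}"
    by (auto simp: first_indices_def r_def)
  then show ?thesis
    using card_vimage_inj[OF inj, of "{..<p}"] assms by (auto simp: range)
qed

text \<open>The cycle word lists every index of \<open>J\<close> exactly once, so the product has
  \<open>card J\<close> factors. Real scalars can be pulled out of each product, whatever the
  bracketing.\<close>

lemma moore_term_scaleR:
  assumes "\<sigma> permutes J"
  shows "moore_term (c *\<^sub>R A) \<sigma> J = c ^ card J *\<^sub>R moore_term A \<sigma> J"
proof -
  \<comment> \<open>The scalar \<open>d\<close> already extracted is kept apart from the accumulator
    \<open>a\<close>, so that the induction goes through.\<close>
  have fold: "foldl (\<lambda>x i. x * (c *\<^sub>R A) $ i $ \<sigma> i) (d *\<^sub>R a) xs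
      = (d * c ^ length xs) *\<^sub>R foldl (\<lambda>x i. x * A $ i $ \<sigma> i) a xs" for d a xs
  proof (induction xs arbitrary: d a)
    case (Cons i xs)
    show ?case
      using Cons.IH[of "d * c" "a * A $ i $ \<sigma> i"]
      by (simp add: nda_scaleR_left nda_scaleR_right mult_ac)
  qed simp
  have "length (cycle_word \<sigma> J) = card J"
    by (metis assms cycle_word_permutes distinct_card)
  then show ?thesis
    using fold[of 1 1] by (simp add: moore_term_def)
qed

lemma leading_det_scaleR:
  fixes A :: "'a::normed_division_algebra^'m::{finite,linorder}^'m::{finite,linorder}"
  assumes "p \<le> CARD('m)"
  shows "leading_det p (c *\<^sub>R A) = c ^ p * leading_det p A"
proof -
  have "(\<Sum>\<sigma> | \<sigma> permutes (first_indices p :: 'm set).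
          of_int (sign \<sigma>) *\<^sub>R moore_term (c *\<^sub>R A) \<sigma> (first_indices p))
      = c ^ p *\<^sub>R (\<Sum>\<sigma> | \<sigma> permutes (first_indices p :: 'm set).
          of_int (sign \<sigma>) *\<^sub>R moore_term A \<sigma> (first_indices p))"
    unfolding scaleR_sum_right
    by (intro sum.cong refl) (simp add: moore_term_scaleR card_first_indices[OF assms] mult.commute)
  then show ?thesis
    by (simp add: leading_det_def re_part_def)
qed

lemma q_power_nonneg: "0 \<le> q_power t A"
  by (simp add: q_power_def prod_nonneg)

text \<open>Summation by parts. The left side is the degree of \<open>q_power\<close>: the minor of
  size \<open>i\<close> has degree \<open>i\<close> and exponent \<open>t i - t (i + 1)\<close>, the
  full determinant has exponent \<open>t (Suc m)\<close>.\<close>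

lemma sum_weighted_differences:
  fixes t :: "nat \<Rightarrow> real"
  shows "real (Suc m) * t (Suc m) + (\<Sum>i = 1..m. real i * (t i - t (i + 1))) = (\<Sum>i = 1..Suc m. t i)"
  by (induction m) (auto simp: algebra_simps)

lemma q_power_scaleR:
  fixes A :: "'a::normed_division_algebra^'m::{finite,linorder}^'m::{finite,linorder}"
  assumes "c > 0"
  shows "q_power t (c *\<^sub>R A) = c powr (\<Sum>i = 1..CARD('m). t i) * q_power t A"
proof -
  \<comment> \<open>Here \<open>d\<close> stands for a minor, which may be negative or zero;
    \<open>powr\<close> acts on the absolute value and so stays multiplicative.\<close>
  have powr: "(c ^ p * d) powr x = c powr (real p * x) * d powr x" for p :: nat and d x :: real
    using assms by (simp add: powr_mult powr_powr flip: powr_realpow)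
  obtain m where m: "CARD('m) = Suc m"
    by (metis card_gt_0_iff finite_UNIV_card_ge_0 finite gr0_implies_Suc)
  have "(\<Prod>i = 1..m. leading_det i (c *\<^sub>R A) powr (t i - t (i + 1)))
      = (\<Prod>i = 1..m. c powr (real i * (t i - t (i + 1))) * leading_det i A powr (t i - t (i + 1)))"
    using m by (intro prod.cong) (auto simp: leading_det_scaleR powr)
  also have "\<dots> = c powr (\<Sum>i = 1..m. real i * (t i - t (i + 1)))
      * (\<Prod>i = 1..m. leading_det i A powr (t i - t (i + 1)))"
    using assms by (simp add: prod.distrib powr_sum)
  finally have minors: "(\<Prod>i = 1..m. leading_det i (c *\<^sub>R A) powr (t i - t (i + 1)))
      = c powr (\<Sum>i = 1..m. real i * (t i - t (i + 1)))
      * (\<Prod>i = 1..m. leading_det i A powr (t i - t (i + 1)))" .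
  have "leading_det (Suc m) (c *\<^sub>R A) powr t (Suc m)
      = c powr (real (Suc m) * t (Suc m)) * leading_det (Suc m) A powr t (Suc m)"
    using m by (simp only: leading_det_scaleR powr)
  then show ?thesis
    unfolding q_power_def m diff_Suc_1 minors sum_weighted_differences[symmetric]
    by (simp only: powr_add mult_ac)
qed

lemma mat_mul_adj_scaleR:
  "mat_mul (mat_adj (c *\<^sub>R X)) (c *\<^sub>R X) = c\<^sup>2 *\<^sub>R mat_mul (mat_adj X) X"
  by (simp add: mat_mul_def mat_adj_def vec_eq_iff nda_conj_scaleR nda_scaleR_left
      nda_scaleR_right scaleR_sum_right power2_eq_square)

section \<open>Dilations of Lebesgue measure and gamma integrals\<close>

lemma nn_integral_lborel_scaleR:
  fixes f :: "'e::euclidean_space \<Rightarrow> ennreal"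
  assumes [measurable]: "f \<in> borel_measurable borel" and "c > 0"
  shows "(\<integral>\<^sup>+x. f x \<partial>lborel) = (\<integral>\<^sup>+x. ennreal (c ^ DIM('e)) * f (c *\<^sub>R x) \<partial>lborel)"
  using assms(2)
  by (subst lborel_affine[of c 0]) (simp_all add: nn_integral_density nn_integral_distr)

text \<open>The primitive \<open>ln\<close> is unbounded below near 0. This divergence later
  excludes nonpositive gamma shapes.\<close>

lemma nn_integral_inverse_at_0: "(\<integral>\<^sup>+s. ennreal (1 / s) * indicator {0<..<1::real} s \<partial>lborel) = \<infinity>"
proof (rule ccontr)
  define I where "I = (\<integral>\<^sup>+s. ennreal (1 / s) * indicator {0<..<1::real} s \<partial>lborel)"
  assume "\<not> I = \<infinity>"
  then obtain i where i: "I = ennreal i" "i \<ge> 0" by (cases I) auto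
  \<comment> \<open>Chosen so that the integral from \<open>e\<close> to 1 equals
    \<open>i + 1\<close>, more than the supposed total \<open>i\<close>.\<close>
  define e where "e = exp (- (i + 1))"
  have e: "e > 0" "ln e = - (i + 1)" by (simp_all add: e_def)
  have "e \<le> 1" using i by (simp add: e_def)
  then have "ennreal (ln 1 - ln e) = (\<integral>\<^sup>+s. ennreal (1 / s) * indicator {e..1} s \<partial>lborel)"
    using e(1) by (intro sym[OF nn_integral_FTC_Icc]) (auto intro!: derivative_eq_intros)
  also have "\<dots> \<le> I"
    unfolding I_def
  proof (rule nn_integral_mono_AE)
    show "AE s in lborel. ennreal (1 / s) * indicator {e..1} s \<le> ennreal (1 / s) * indicator {0<..<1} s"
      using AE_lborel_singleton[of "1::real"]
      by eventually_elim (use e(1) in \<open>auto simp: indicator_def\<close>)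
  qed
  finally show False using i e by simp
qed

text \<open>The gamma density of shape \<open>a\<close> and rate \<open>\<beta>\<close> without its
  constant. The one-dimensional Riesz law with parameters a and k is the gamma law of shape a +
  k.\<close>

definition gamma_kernel :: "real \<Rightarrow> real \<Rightarrow> real \<Rightarrow> real"
  where "gamma_kernel \<beta> a s = (if s > 0 then exp (- \<beta> * s) * s powr (a - 1) else 0)"

lemma gamma_kernel_nonneg: "0 \<le> gamma_kernel \<beta> a s"
  by (simp add: gamma_kernel_def)

lemma gamma_kernel_measurable [measurable]: "gamma_kernel \<beta> a \<in> borel_measurable borel"
  unfolding gamma_kernel_def by measurable

text \<open>Euler's integral with \<open>\<beta> * s\<close> substituted for the variable.\<close>

lemma nn_integral_gamma_kernel:
  assumes "\<beta> > 0" "a > 0"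
  shows "(\<integral>\<^sup>+s. gamma_kernel \<beta> a s \<partial>lborel) = ennreal (Gamma a / \<beta> powr a)"
proof -
  have "ennreal (Gamma a) = (\<integral>\<^sup>+s. ennreal (indicator {0..} s * s powr (a - 1) / exp s) \<partial>lborel)"
    using assms by (rule_tac Gamma_conv_nn_integral_real)
  also have "\<dots> = (\<integral>\<^sup>+s. ennreal (\<beta> powr a) * gamma_kernel \<beta> a s \<partial>lborel)"
    using assms
    by (subst nn_integral_real_affine[of _ \<beta> 0])
       (auto simp: gamma_kernel_def indicator_def exp_minus field_simps powr_mult powr_diff
          zero_le_mult_iff simp flip: ennreal_mult nn_integral_cmult intro!: nn_integral_cong)
  also have "\<dots> = ennreal (\<beta> powr a) * (\<integral>\<^sup>+s. gamma_kernel \<beta> a s \<partial>lborel)"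
    by (rule nn_integral_cmult) measurable
  finally have *: "ennreal (Gamma a) = ennreal (\<beta> powr a) * (\<integral>\<^sup>+s. gamma_kernel \<beta> a s \<partial>lborel)" .
  have "ennreal (Gamma a / \<beta> powr a) = ennreal (1 / \<beta> powr a) * ennreal (Gamma a)"
    using assms by (simp flip: ennreal_mult)
  also have "\<dots> = (\<integral>\<^sup>+s. gamma_kernel \<beta> a s \<partial>lborel)"
    unfolding * using assms by (simp flip: mult.assoc ennreal_mult)
  finally show ?thesis by simp
qed

text \<open>On the interval from 0 to 1 the kernel dominates \<open>exp (- \<beta>) / s\<close>,
  because the exponent \<open>a - 1\<close> is at most -1.\<close>

lemma nn_integral_gamma_kernel_nonpos:
  assumes "\<beta> > 0" "a \<le> 0"
  shows "(\<integral>\<^sup>+s. gamma_kernel \<beta> a s \<partial>lborel) = \<infinity>"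
proof -
  have "\<infinity> = ennreal (exp (- \<beta>)) * (\<integral>\<^sup>+s. ennreal (1 / s) * indicator {0<..<1::real} s \<partial>lborel)"
    by (simp add: nn_integral_inverse_at_0 ennreal_mult_top)
  also have "\<dots> = (\<integral>\<^sup>+s. ennreal (exp (- \<beta>)) * (ennreal (1 / s) * indicator {0<..<1::real} s) \<partial>lborel)"
    by (rule nn_integral_cmult[symmetric]) measurable
  also have "\<dots> \<le> (\<integral>\<^sup>+s. gamma_kernel \<beta> a s \<partial>lborel)"
  proof (rule nn_integral_mono)
    fix s :: real
    have "exp (- \<beta>) * (1 / s) \<le> gamma_kernel \<beta> a s" if "0 < s" "s < 1"
    proof -
      have "1 / s = s powr (- 1)" using that by (simp add: powr_minus_divide)
      also have "\<dots> \<le> s powr (a - 1)" using that assms by (intro powr_mono') auto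
      finally have "exp (- \<beta>) * (1 / s) \<le> exp (- \<beta> * s) * s powr (a - 1)"
        using that assms by (intro mult_mono) auto
      then show ?thesis
        using that by (simp add: gamma_kernel_def)
    qed
    then show "ennreal (exp (- \<beta>)) * (ennreal (1 / s) * indicator {0<..<1} s) \<le> gamma_kernel \<beta> a s"
      by (auto simp: indicator_def simp flip: ennreal_mult intro!: ennreal_leI)
  qed
  finally show ?thesis by (simp add: top.extremum_unique)
qed

section \<open>A gamma variable and an independent vector with homogeneous density factor\<close>

text \<open>Matrices become vectors of an arbitrary Euclidean space and the generalised power
  becomes a nonnegative function homogeneous of degree \<open>2 * T\<close>. The parameter
  \<open>b\<close> stands for \<nu>\<beta>/2 + k and \<open>C\<close> for the Kotz-Riesz
  constant.\<close>

locale gamma_radial_pair = prob_space M for M :: "'w measure" +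
  fixes \<beta> b C T :: real and q :: "'e::euclidean_space \<Rightarrow> real"
    and S1 :: "'w \<Rightarrow> real" and Y :: "'w \<Rightarrow> 'e"
  assumes \<beta>_pos: "\<beta> > 0" and b_pos: "b > 0"
    and S1: "distributed M lborel S1 (\<lambda>v. ennreal (\<beta> powr b / Gamma b * gamma_kernel \<beta> b v))"
    and Y: "distributed M lborel Y (\<lambda>y. ennreal (C * exp (- \<beta> * (norm y)\<^sup>2) * q y))"
    and q_nonneg: "\<And>y. 0 \<le> q y"
    and q_scaleR: "\<And>c y. c > 0 \<Longrightarrow> q (c *\<^sub>R y) = c powr (2 * T) * q y"
    and indep: "indep_rv M borel S1 borel Y"
begin

definition "S = (\<lambda>\<omega>. S1 \<omega> + (norm (Y \<omega>))\<^sup>2)"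

definition "R = (\<lambda>\<omega>. S \<omega> powr (- 1 / 2) *\<^sub>R Y \<omega>)"

text \<open>The summands are the contributions to the power of s: from the density of
  \<open>S1\<close>, from the Jacobian of the dilation by \<open>sqrt s\<close>, and from the
  homogeneity of \<open>q\<close>.\<close>

definition "shape = b + real DIM('e) / 2 + T"

text \<open>The constants of both given densities are kept here, so that the product with
  \<open>gamma_kernel \<beta> shape\<close> is exactly the joint density; the kernel alone need not
  have mass 1.\<close>

definition pearson_kernel :: "'e \<Rightarrow> real"
  where "pearson_kernel r = (if 1 - (norm r)\<^sup>2 > 0 then
    C * \<beta> powr b / Gamma b * (1 - (norm r)\<^sup>2) powr (b - 1) * q r else 0)"

lemma measurable_S1 [measurable]: "S1 \<in> borel_measurable M"
  using distributed_measurable[OF S1] by simp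

lemma measurable_Y [measurable]: "Y \<in> borel_measurable M"
  using distributed_measurable[OF Y] by simp

lemma measurable_S [measurable]: "S \<in> borel_measurable M"
  unfolding S_def by measurable

lemma measurable_R [measurable]: "R \<in> borel_measurable M"
  unfolding R_def by measurable

text \<open>The gamma factors in the Kotz--Riesz constant may be negative, so positivity of \<open>C\<close> is not
  assumed; a nonpositive \<open>C\<close> would give \<open>Y\<close> the zero law because \<open>ennreal\<close> truncates.\<close>

lemma C_pos: "C > 0"
proof (rule ccontr)
  assume "\<not> C > 0"
  then have "ennreal (C * exp (- \<beta> * (norm y)\<^sup>2) * q y) = 0" for y
    using q_nonneg[of y] by (simp add: ennreal_eq_0_iff mult_nonpos_nonneg)
  then have "distr M lborel Y = density lborel (\<lambda>_. 0)"
    using distributed_distr_eq_density[OF Y] by simp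
  then have "emeasure (distr M lborel Y) UNIV = 0"
    by (simp add: emeasure_density)
  then show False
    by (simp add: emeasure_distr emeasure_space_1)
qed

text \<open>Dividing the measurable density of \<open>Y\<close> by the positive factor
  \<open>C * exp (- \<beta> * (norm y)\<^sup>2)\<close> recovers \<open>q\<close>;
  \<open>enn2real\<close> loses nothing because the density is nonnegative.\<close>

lemma measurable_q [measurable]: "q \<in> borel_measurable borel"
proof -
  have "(\<lambda>y. ennreal (C * exp (- \<beta> * (norm y)\<^sup>2) * q y)) \<in> borel_measurable borel"
    using distributed_borel_measurable[OF Y] by simp
  then have "(\<lambda>y. enn2real (ennreal (C * exp (- \<beta> * (norm y)\<^sup>2) * q y)) / (C * exp (- \<beta> * (norm y)\<^sup>2)))
      \<in> borel_measurable borel"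
    by measurable
  then show ?thesis
    using C_pos q_nonneg by simp
qed

lemma pearson_kernel_nonneg: "0 \<le> pearson_kernel r"
  using C_pos b_pos q_nonneg[of r] by (auto simp: pearson_kernel_def)

lemma measurable_pearson_kernel [measurable]: "pearson_kernel \<in> borel_measurable borel"
  unfolding pearson_kernel_def by measurable

section \<open>The joint law of \<open>S\<close> and \<open>R\<close>\<close>

text \<open>Independence of the generated sigma-algebras gives the joint law on rectangles, and
  these determine a product of sigma-finite measures.\<close>

lemma distr_pair:
  "distr M (borel \<Otimes>\<^sub>M borel) (\<lambda>\<omega>. (S1 \<omega>, Y \<omega>)) = distr M borel S1 \<Otimes>\<^sub>M distr M borel Y"
proof (rule pair_measure_eqI[symmetric])
  show "sigma_finite_measure (distr M borel S1)" "sigma_finite_measure (distr M borel Y)"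
    by (auto intro!: prob_space_imp_sigma_finite prob_space_distr)
  fix A B assume "A \<in> sets (distr M borel S1)" "B \<in> sets (distr M borel Y)"
  then have [measurable]: "A \<in> sets borel" "B \<in> sets borel" by auto
  have "prob ((S1 -` A \<inter> space M) \<inter> (Y -` B \<inter> space M))
      = prob (S1 -` A \<inter> space M) * prob (Y -` B \<inter> space M)"
    using indep unfolding indep_rv_def by (intro indep_setD) auto
  moreover have "(\<lambda>\<omega>. (S1 \<omega>, Y \<omega>)) -` (A \<times> B) \<inter> space M = (S1 -` A \<inter> space M) \<inter> (Y -` B \<inter> space M)"
    by auto
  ultimately show "emeasure (distr M borel S1) A * emeasure (distr M borel Y) B
      = emeasure (distr M (borel \<Otimes>\<^sub>M borel) (\<lambda>\<omega>. (S1 \<omega>, Y \<omega>))) (A \<times> B)"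
    by (simp add: emeasure_distr emeasure_eq_measure flip: ennreal_mult)
next
  show "sets (distr M borel S1 \<Otimes>\<^sub>M distr M borel Y)
      = sets (distr M (borel \<Otimes>\<^sub>M borel) (\<lambda>\<omega>. (S1 \<omega>, Y \<omega>)))"
    by (simp cong: sets_pair_measure_cong)
qed

text \<open>The leading power of \<open>s\<close> is the Jacobian of the dilation by
  \<open>sqrt s\<close>. The exponentials lose their dependence on \<open>r\<close> and all powers
  of \<open>s\<close> collect, which is the factorisation behind independence.\<close>

lemma density_scaleR:
  assumes "s > 0"
  shows "s powr (real DIM('e) / 2) * (\<beta> powr b / Gamma b * gamma_kernel \<beta> b (s - (norm (sqrt s *\<^sub>R r))\<^sup>2)
      * (C * exp (- \<beta> * (norm (sqrt s *\<^sub>R r))\<^sup>2) * q (sqrt s *\<^sub>R r)))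
    = gamma_kernel \<beta> shape s * pearson_kernel r"
proof -
  \<comment> \<open>The argument of the kernel of \<open>S1\<close> becomes
    \<open>s * \<rho>\<close>, which is positive exactly when \<open>r\<close> lies in the open unit
    ball; elsewhere both sides vanish.\<close>
  define \<rho> where "\<rho> = 1 - (norm r)\<^sup>2"
  have norm: "(norm (sqrt s *\<^sub>R r))\<^sup>2 = s - s * \<rho>"
    using assms by (simp add: \<rho>_def power_mult_distrib algebra_simps)
  show ?thesis
  proof (cases "\<rho> > 0")
    case True
    have "q (sqrt s *\<^sub>R r) = s powr T * q r"
      using assms by (simp add: q_scaleR powr_powr flip: powr_half_sqrt)
    moreover have "gamma_kernel \<beta> b (s * \<rho>) = exp (- \<beta> * (s * \<rho>)) * s powr (b - 1) * \<rho> powr (b - 1)"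
      using assms True by (simp add: gamma_kernel_def powr_mult)
    moreover have "exp (- \<beta> * (s * \<rho>)) * exp (- \<beta> * (s - s * \<rho>)) = exp (- \<beta> * s)"
      by (simp add: algebra_simps flip: exp_add)
    moreover have "s powr (shape - 1) = s powr (b - 1) * s powr (real DIM('e) / 2) * s powr T"
      by (simp add: shape_def algebra_simps flip: powr_add)
    moreover have "pearson_kernel r = C * \<beta> powr b / Gamma b * \<rho> powr (b - 1) * q r"
      unfolding pearson_kernel_def \<rho>_def[symmetric] using True by simp
    moreover have "gamma_kernel \<beta> shape s = exp (- \<beta> * s) * s powr (shape - 1)"
      using assms by (simp add: gamma_kernel_def)
    moreover have "s - (s - s * \<rho>) = s * \<rho>"
      by simp
    ultimately show ?thesis
      unfolding norm by (simp only: times_divide_eq_left times_divide_eq_right mult_ac)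
  next
    case False
    then have "gamma_kernel \<beta> b (s * \<rho>) = 0"
      using assms by (simp add: gamma_kernel_def zero_less_mult_iff)
    moreover have "pearson_kernel r = 0"
      unfolding pearson_kernel_def \<rho>_def[symmetric] using False by simp
    moreover have "s - (s - s * \<rho>) = s * \<rho>"
      by simp
    ultimately show ?thesis
      unfolding norm by simp
  qed
qed

text \<open>With an arbitrary test function, total mass, marginal laws and independence can all be
  read off by choosing \<open>f\<close>.\<close>

lemma nn_integral_standardised:
  fixes f :: "real \<times> 'e \<Rightarrow> ennreal"
  assumes [measurable]: "f \<in> borel_measurable (borel \<Otimes>\<^sub>M borel)"
  shows "(\<integral>\<^sup>+\<omega>. f (S \<omega>, R \<omega>) \<partial>M)
    = (\<integral>\<^sup>+s. \<integral>\<^sup>+r. f (s, r) * (ennreal (gamma_kernel \<beta> shape s) * ennreal (pearson_kernel r)) \<partial>lborel \<partial>lborel)"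
proof -
  define p1 where "p1 v = \<beta> powr b / Gamma b * gamma_kernel \<beta> b v" for v
  define p2 where "p2 y = C * exp (- \<beta> * (norm y)\<^sup>2) * q y" for y
  have [measurable]: "p1 \<in> borel_measurable borel" "p2 \<in> borel_measurable borel"
    unfolding p1_def p2_def by measurable
  have p_nonneg: "0 \<le> p1 v" "0 \<le> p2 y" for v y
    using b_pos C_pos q_nonneg by (simp_all add: p1_def p2_def gamma_kernel_nonneg)
  have p1_0: "p1 v = 0" if "v \<le> 0" for v
    using that by (simp add: p1_def gamma_kernel_def)
  have distr_S1: "distr M borel S1 = density lborel p1"
    using distributed_distr_eq_density[OF S1] by (simp add: p1_def cong: distr_cong)
  have distr_Y: "distr M borel Y = density lborel p2"
    using distributed_distr_eq_density[OF Y] by (simp add: p2_def cong: distr_cong)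
  \<comment> \<open>The test function in terms of \<open>S\<close> and \<open>Y\<close>; the change
    from \<open>Y\<close> to \<open>R\<close> is postponed until \<open>s\<close> is fixed.\<close>
  define g where "g s y = f (s, s powr (- 1 / 2) *\<^sub>R y)" for s y
  have [measurable]: "(\<lambda>x. g (fst x) (snd x)) \<in> borel_measurable (borel \<Otimes>\<^sub>M borel)"
    unfolding g_def by measurable
  have [measurable]: "case_prod g \<in> borel_measurable (borel \<Otimes>\<^sub>M borel)"
    using \<open>(\<lambda>x. g (fst x) (snd x)) \<in> _\<close> by (simp add: case_prod_beta')
  interpret Y: prob_space "distr M borel Y" by (rule prob_space_distr) measurable
  interpret S1: prob_space "distr M borel S1" by (rule prob_space_distr) measurable
  interpret pair_sigma_finite "distr M borel S1" "distr M borel Y" ..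
  have "(\<integral>\<^sup>+\<omega>. f (S \<omega>, R \<omega>) \<partial>M) = (\<integral>\<^sup>+\<omega>. g (S1 \<omega> + (norm (Y \<omega>))\<^sup>2) (Y \<omega>) \<partial>M)"
    by (simp add: g_def S_def R_def)
  also have "\<dots> = (\<integral>\<^sup>+x. g (fst x + (norm (snd x))\<^sup>2) (snd x) \<partial>(distr M borel S1 \<Otimes>\<^sub>M distr M borel Y))"
    by (subst distr_pair[symmetric], subst nn_integral_distr) simp_all
  also have "\<dots> = (\<integral>\<^sup>+y. \<integral>\<^sup>+v. g (v + (norm y)\<^sup>2) y \<partial>distr M borel S1 \<partial>distr M borel Y)"
    by (subst nn_integral_snd[symmetric]) (simp_all add: case_prod_beta')
  also have "\<dots> = (\<integral>\<^sup>+y. p2 y * (\<integral>\<^sup>+v. p1 v * g (v + (norm y)\<^sup>2) y \<partial>lborel) \<partial>lborel)"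
    unfolding distr_S1 distr_Y by (simp add: nn_integral_density)
  also have "\<dots> = (\<integral>\<^sup>+y. p2 y * (\<integral>\<^sup>+s. p1 (s - (norm y)\<^sup>2) * g s y \<partial>lborel) \<partial>lborel)"
  proof -
    have "(\<integral>\<^sup>+v. p1 v * g (v + (norm y)\<^sup>2) y \<partial>lborel) = (\<integral>\<^sup>+s. p1 (s - (norm y)\<^sup>2) * g s y \<partial>lborel)" for y
      by (subst nn_integral_real_affine[of _ 1 "- (norm y)\<^sup>2"]) simp_all
    then show ?thesis by simp
  qed
  also have "\<dots> = (\<integral>\<^sup>+y. \<integral>\<^sup>+s. p2 y * (p1 (s - (norm y)\<^sup>2) * g s y) \<partial>lborel \<partial>lborel)"
    by (simp add: nn_integral_cmult)
  also have "\<dots> = (\<integral>\<^sup>+s. \<integral>\<^sup>+y. p2 y * (p1 (s - (norm y)\<^sup>2) * g s y) \<partial>lborel \<partial>lborel)"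
    by (rule lborel_pair.Fubini') measurable
  also have "\<dots> = (\<integral>\<^sup>+s. \<integral>\<^sup>+r. f (s, r) * (ennreal (gamma_kernel \<beta> shape s) * ennreal (pearson_kernel r)) \<partial>lborel \<partial>lborel)"
  proof (rule nn_integral_cong)
    fix s :: real
    show "(\<integral>\<^sup>+y. p2 y * (p1 (s - (norm y)\<^sup>2) * g s y) \<partial>lborel)
        = (\<integral>\<^sup>+r. f (s, r) * (ennreal (gamma_kernel \<beta> shape s) * ennreal (pearson_kernel r)) \<partial>lborel)"
    proof (cases "s > 0")
      case True
      have "(\<integral>\<^sup>+y. p2 y * (p1 (s - (norm y)\<^sup>2) * g s y) \<partial>lborel)
          = (\<integral>\<^sup>+r. ennreal (sqrt s ^ DIM('e)) * (p2 (sqrt s *\<^sub>R r)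
              * (p1 (s - (norm (sqrt s *\<^sub>R r))\<^sup>2) * g s (sqrt s *\<^sub>R r))) \<partial>lborel)"
        using True by (intro nn_integral_lborel_scaleR) auto
      also have "\<dots> = (\<integral>\<^sup>+r. f (s, r) * (ennreal (gamma_kernel \<beta> shape s) * ennreal (pearson_kernel r)) \<partial>lborel)"
      proof (rule nn_integral_cong)
        fix r :: 'e
        have "sqrt s ^ DIM('e) = s powr (real DIM('e) / 2)"
          using True by (simp add: powr_powr flip: powr_half_sqrt powr_realpow)
        then have "sqrt s ^ DIM('e) * (p1 (s - (norm (sqrt s *\<^sub>R r))\<^sup>2) * p2 (sqrt s *\<^sub>R r))
            = gamma_kernel \<beta> shape s * pearson_kernel r"
          using density_scaleR[OF True, of r] by (simp only: p1_def p2_def)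
        then have "ennreal (sqrt s ^ DIM('e)) * (ennreal (p1 (s - (norm (sqrt s *\<^sub>R r))\<^sup>2)) * ennreal (p2 (sqrt s *\<^sub>R r)))
            = ennreal (gamma_kernel \<beta> shape s) * ennreal (pearson_kernel r)"
          using True by (simp add: p_nonneg gamma_kernel_nonneg pearson_kernel_nonneg flip: ennreal_mult)
        moreover have "g s (sqrt s *\<^sub>R r) = f (s, r)"
          using True by (simp add: g_def powr_minus_divide flip: powr_half_sqrt)
        ultimately show "ennreal (sqrt s ^ DIM('e)) * (p2 (sqrt s *\<^sub>R r)
              * (p1 (s - (norm (sqrt s *\<^sub>R r))\<^sup>2) * g s (sqrt s *\<^sub>R r)))
            = f (s, r) * (ennreal (gamma_kernel \<beta> shape s) * ennreal (pearson_kernel r))"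
          by (simp add: mult_ac)
      qed
      finally show ?thesis .
    next
      case False
      \<comment> \<open>For nonpositive \<open>s\<close> the density of \<open>S1\<close> is
        evaluated at a nonpositive point, so the value of \<open>s powr (- 1 / 2)\<close> inside
        \<open>g\<close> is multiplied by zero.\<close>
      have "p1 (s - (norm y)\<^sup>2) = 0" for y :: 'e
        using False by (intro p1_0) (simp add: order_trans[of s 0])
      then show ?thesis
        using False by (simp add: gamma_kernel_def)
    qed
  qed
  finally show ?thesis .
qed

section \<open>Normalisation of the two kernels\<close>

text \<open>The two kernels depend on different variables, so for a product test function the double
  integral splits.\<close>

lemma nn_integral_standardised_mult:
  assumes [measurable]: "f \<in> borel_measurable borel" "g \<in> borel_measurable borel"
  shows "(\<integral>\<^sup>+\<omega>. f (S \<omega>) * g (R \<omega>) \<partial>M)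
    = (\<integral>\<^sup>+s. f s * ennreal (gamma_kernel \<beta> shape s) \<partial>lborel) * (\<integral>\<^sup>+r. g r * ennreal (pearson_kernel r) \<partial>lborel)"
proof -
  have "(\<integral>\<^sup>+\<omega>. f (S \<omega>) * g (R \<omega>) \<partial>M)
      = (\<integral>\<^sup>+s. \<integral>\<^sup>+r. f s * ennreal (gamma_kernel \<beta> shape s) * (g r * ennreal (pearson_kernel r)) \<partial>lborel \<partial>lborel)"
    using nn_integral_standardised[of "\<lambda>x. f (fst x) * g (snd x)"] by (simp add: mult_ac)
  also have "\<dots> = (\<integral>\<^sup>+s. f s * ennreal (gamma_kernel \<beta> shape s) \<partial>lborel) * (\<integral>\<^sup>+r. g r * ennreal (pearson_kernel r) \<partial>lborel)"
    by (simp add: nn_integral_cmult nn_integral_multc)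
  finally show ?thesis .
qed

text \<open>With a nonpositive shape the total mass 1 would be an infinite integral over \<open>s\<close> times
  another factor.\<close>

lemma shape_pos: "shape > 0"
proof (rule ccontr)
  assume "\<not> shape > 0"
  then have "(\<integral>\<^sup>+s. gamma_kernel \<beta> shape s \<partial>lborel) = \<infinity>"
    using \<beta>_pos by (intro nn_integral_gamma_kernel_nonpos) auto
  then have "1 = \<infinity> * (\<integral>\<^sup>+r. pearson_kernel r \<partial>lborel)"
    using nn_integral_standardised_mult[of "\<lambda>_. 1" "\<lambda>_. 1"] by (simp add: emeasure_space_1)
  then show False
    by (simp add: ennreal_top_mult split: if_splits)
qed

text \<open>The total mass of the gamma kernel with parameter \<open>shape\<close>.\<close>

definition "Z = Gamma shape / \<beta> powr shape"

lemma Z_pos: "Z > 0"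
  using shape_pos \<beta>_pos by (simp add: Z_def)

lemma nn_integral_gamma_kernel_shape: "(\<integral>\<^sup>+s. gamma_kernel \<beta> shape s \<partial>lborel) = ennreal Z"
  unfolding Z_def using \<beta>_pos shape_pos by (rule nn_integral_gamma_kernel)

text \<open>Constant test functions give total mass 1, so this mass is the reciprocal of the gamma
  mass and no integral over \<open>'e\<close> has to be evaluated.\<close>

lemma nn_integral_pearson_kernel: "(\<integral>\<^sup>+r. pearson_kernel r \<partial>lborel) = ennreal (1 / Z)"
proof -
  have "1 = ennreal Z * (\<integral>\<^sup>+r. pearson_kernel r \<partial>lborel)"
    using nn_integral_standardised_mult[of "\<lambda>_. 1" "\<lambda>_. 1"]
    by (simp add: emeasure_space_1 nn_integral_gamma_kernel_shape)
  then have "ennreal (1 / Z) * 1 = ennreal (1 / Z) * (ennreal Z * (\<integral>\<^sup>+r. pearson_kernel r \<partial>lborel))"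
    by simp
  then show ?thesis
    using Z_pos by (simp flip: mult.assoc ennreal_mult)
qed

section \<open>Marginal laws and independence\<close>

text \<open>A test function constant in \<open>R\<close> leaves the mass of the Pearson kernel as a
  factor.\<close>

lemma emeasure_S:
  assumes [measurable]: "A \<in> sets borel"
  shows "emeasure M (S -` A \<inter> space M) = (\<integral>\<^sup>+s. indicator A s * ennreal (gamma_kernel \<beta> shape s) \<partial>lborel) * ennreal (1 / Z)"
proof -
  have "emeasure M (S -` A \<inter> space M) = (\<integral>\<^sup>+\<omega>. indicator (S -` A \<inter> space M) \<omega> \<partial>M)"
    by (rule nn_integral_indicator[symmetric]) measurable
  also have "\<dots> = (\<integral>\<^sup>+\<omega>. indicator A (S \<omega>) * 1 \<partial>M)"
    by (rule nn_integral_cong) (auto simp: indicator_def)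
  also have "\<dots> = (\<integral>\<^sup>+s. indicator A s * ennreal (gamma_kernel \<beta> shape s) \<partial>lborel) * ennreal (1 / Z)"
    by (subst nn_integral_standardised_mult) (simp_all add: nn_integral_pearson_kernel)
  finally show ?thesis .
qed

lemma emeasure_R:
  assumes [measurable]: "B \<in> sets borel"
  shows "emeasure M (R -` B \<inter> space M) = ennreal Z * (\<integral>\<^sup>+r. indicator B r * ennreal (pearson_kernel r) \<partial>lborel)"
proof -
  have "emeasure M (R -` B \<inter> space M) = (\<integral>\<^sup>+\<omega>. indicator (R -` B \<inter> space M) \<omega> \<partial>M)"
    by (rule nn_integral_indicator[symmetric]) measurable
  also have "\<dots> = (\<integral>\<^sup>+\<omega>. 1 * indicator B (R \<omega>) \<partial>M)"
    by (rule nn_integral_cong) (auto simp: indicator_def)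
  also have "\<dots> = ennreal Z * (\<integral>\<^sup>+r. indicator B r * ennreal (pearson_kernel r) \<partial>lborel)"
    by (subst nn_integral_standardised_mult) (simp_all add: nn_integral_gamma_kernel_shape)
  finally show ?thesis .
qed

lemma distributed_S: "distributed M lborel S (\<lambda>s. ennreal (gamma_kernel \<beta> shape s / Z))"
  unfolding distributed_def
proof (intro conjI measure_eqI)
  fix A assume "A \<in> sets (distr M lborel S)"
  then have [measurable]: "A \<in> sets borel" by simp
  have "ennreal (gamma_kernel \<beta> shape s / Z) = ennreal (gamma_kernel \<beta> shape s) * ennreal (1 / Z)" for s
    using Z_pos by (simp add: gamma_kernel_nonneg flip: ennreal_mult)
  then show "emeasure (distr M lborel S) A
      = emeasure (density lborel (\<lambda>s. ennreal (gamma_kernel \<beta> shape s / Z))) A"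
    by (simp add: emeasure_distr emeasure_S emeasure_density mult_ac flip: nn_integral_cmult)
qed simp_all

lemma distributed_R: "distributed M lborel R (\<lambda>r. ennreal (Z * pearson_kernel r))"
  unfolding distributed_def
proof (intro conjI measure_eqI)
  fix B assume "B \<in> sets (distr M lborel R)"
  then have [measurable]: "B \<in> sets borel" by simp
  have "ennreal (Z * pearson_kernel r) = ennreal Z * ennreal (pearson_kernel r)" for r
    using Z_pos by (simp add: pearson_kernel_nonneg flip: ennreal_mult)
  then show "emeasure (distr M lborel R) B
      = emeasure (density lborel (\<lambda>r. ennreal (Z * pearson_kernel r))) B"
    by (simp add: emeasure_distr emeasure_R emeasure_density mult_ac flip: nn_integral_cmult)
qed simp_all

lemma indep_S_R: "indep_rv M borel S borel R"
proof -
  have "prob ((S -` A \<inter> space M) \<inter> (R -` B \<inter> space M)) = prob (S -` A \<inter> space M) * prob (R -` B \<inter> space M)"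
    if [measurable]: "A \<in> sets borel" "B \<in> sets borel" for A B
  proof -
    have "emeasure M ((S -` A \<inter> space M) \<inter> (R -` B \<inter> space M))
        = (\<integral>\<^sup>+\<omega>. indicator ((S -` A \<inter> space M) \<inter> (R -` B \<inter> space M)) \<omega> \<partial>M)"
      by (rule nn_integral_indicator[symmetric]) measurable
    also have "\<dots> = (\<integral>\<^sup>+\<omega>. indicator A (S \<omega>) * indicator B (R \<omega>) \<partial>M)"
      by (rule nn_integral_cong) (auto simp: indicator_def)
    also have "\<dots> = (\<integral>\<^sup>+s. indicator A s * ennreal (gamma_kernel \<beta> shape s) \<partial>lborel)
        * (\<integral>\<^sup>+r. indicator B r * ennreal (pearson_kernel r) \<partial>lborel)"
      by (rule nn_integral_standardised_mult) measurable
    \<comment> \<open>The inserted factor 1, written as \<open>1 / Z\<close> times \<open>Z\<close>,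
      supplies each integral with its own normalising constant.\<close>
    also have "\<dots> = (\<integral>\<^sup>+s. indicator A s * ennreal (gamma_kernel \<beta> shape s) \<partial>lborel) * (ennreal (1 / Z) * ennreal Z)
        * (\<integral>\<^sup>+r. indicator B r * ennreal (pearson_kernel r) \<partial>lborel)"
      using Z_pos by (simp flip: ennreal_mult)
    also have "\<dots> = emeasure M (S -` A \<inter> space M) * emeasure M (R -` B \<inter> space M)"
      by (simp add: emeasure_S emeasure_R mult_ac)
    finally show ?thesis
      by (simp add: emeasure_eq_measure flip: ennreal_mult)
  qed
  then show ?thesis
    by (auto simp: indep_rv_def indep_sets2_eq)
qed

end

section \<open>Specialisation to matrices over a normed division algebra\<close>

theorem theorem3p1:
  fixes M :: "'w measure"
    and \<beta> \<nu> k :: real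
    and t :: "nat \<Rightarrow> real"
    and S1 S :: "'w \<Rightarrow> real"
    and Y R :: "'w \<Rightarrow> 'a::normed_division_algebra^'m::{finite,linorder}^'n::finite"
  assumes "prob_space M"
    and "\<beta> \<in> {1, 2, 4, 8}"
    and "\<beta> = real DIM('a)"
    and "CARD('m) \<le> CARD('n)"
    and "\<nu> * \<beta> / 2 > - k"
    and "real CARD('n) * \<beta> / 2 > (real CARD('m) - 1) * \<beta> / 2 - t CARD('m)"
    and "riesz1 M \<beta> (\<nu> * \<beta> / 2) k S1"
    and "kotz_riesz M \<beta> t Y"
    and "indep_rv M borel S1 borel Y"
    and "S = (\<lambda>\<omega>. S1 \<omega> + (mat_norm (Y \<omega>))\<^sup>2)"
    and "R = (\<lambda>\<omega>. S \<omega> powr (- 1 / 2) *\<^sub>R Y \<omega>)"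
  shows "riesz1 M \<beta> ((\<nu> + real CARD('m) * real CARD('n)) * \<beta> / 2 + (\<Sum>i = 1..CARD('m). t i)) k S \<and>
    indep_rv M borel S borel R \<and>
    distributed M lborel R (\<lambda>X. ennreal
      (if 1 - (mat_norm X)\<^sup>2 > 0 then
         multi_gamma \<beta> CARD('m) (real CARD('n) * \<beta> / 2) (\<lambda>_. 0) *
         multi_gamma \<beta> 1 ((\<nu> + real CARD('m) * real CARD('n)) * \<beta> / 2 + k + (\<Sum>i = 1..CARD('m). t i)) (\<lambda>_. 0)
         / (pi powr (\<beta> * real CARD('m) * real CARD('n) / 2) *
            multi_gamma \<beta> CARD('m) (real CARD('n) * \<beta> / 2) t *
            multi_gamma \<beta> 1 (\<nu> * \<beta> / 2 + k) (\<lambda>_. 0))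
         * (1 - (mat_norm X)\<^sup>2) powr (\<nu> * \<beta> / 2 + k - 1) * q_power t (mat_mul (mat_adj X) X)
       else 0))"
proof -
  define b where "b = \<nu> * \<beta> / 2 + k"
  define T where "T = (\<Sum>i = 1..CARD('m). t i)"
  \<comment> \<open>Half the real dimension of the matrix space.\<close>
  define e where "e = real CARD('m) * real CARD('n) * \<beta> / 2"
  define G where "G = multi_gamma \<beta> CARD('m) (real CARD('n) * \<beta> / 2) (\<lambda>_. 0)"
  define D where "D = pi powr e * multi_gamma \<beta> CARD('m) (real CARD('n) * \<beta> / 2) t"
  define q where "q = (\<lambda>X :: 'a^'m::{finite,linorder}^'n. q_power t (mat_mul (mat_adj X) X))"
  have \<beta>: "\<beta> > 0" and b: "b > 0"
    using assms(2,5) by (auto simp: b_def)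
  interpret M: prob_space M by fact
  interpret L: gamma_radial_pair M \<beta> b "\<beta> powr (e + T) * G / D" T q S1 Y
  proof
    have "(\<lambda>v. ennreal (if v > 0 then \<beta> powr b / Gamma b * exp (- \<beta> * v) * v powr (b - 1) else 0))
        = (\<lambda>v. ennreal (\<beta> powr b / Gamma b * gamma_kernel \<beta> b v))"
      by (rule ext) (simp add: gamma_kernel_def mult.assoc)
    then show "distributed M lborel S1 (\<lambda>v. ennreal (\<beta> powr b / Gamma b * gamma_kernel \<beta> b v))"
      using assms(7) unfolding riesz1_def b_def[symmetric] by simp
    have "kotz_riesz_density \<beta> t = (\<lambda>X :: 'a^'m::{finite,linorder}^'n. \<beta> powr (e + T) * G / D * exp (- \<beta> * (norm X)\<^sup>2) * q X)"
      by (simp add: kotz_riesz_density_def Let_def fun_eq_iff mat_tr_adj_mul G_def D_def e_def T_def q_def)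
    then show "distributed M lborel Y (\<lambda>X. ennreal (\<beta> powr (e + T) * G / D * exp (- \<beta> * (norm X)\<^sup>2) * q X))"
      using assms(8) by (simp add: kotz_riesz_def)
    show "q (c *\<^sub>R X) = c powr (2 * T) * q X" if "c > 0" for c X
    proof -
      \<comment> \<open>The Gram matrix is quadratic in \<open>X\<close>, so a generalised power of
        degree \<open>T\<close> in it has degree \<open>2 * T\<close> in \<open>X\<close>.\<close>
      have "(c\<^sup>2) powr T = c powr (2 * T)"
        using that by (simp add: powr_powr flip: powr_numeral)
      then show ?thesis
        using that by (simp add: q_def T_def mat_mul_adj_scaleR q_power_scaleR)
    qed
  qed (use \<beta> b assms(9) in \<open>simp_all add: q_def q_power_nonneg\<close>)
  have S: "L.S = S" and R: "L.R = R"
    by (simp_all add: fun_eq_iff L.S_def L.R_def assms(10,11) mat_norm_eq_norm)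
  have shape: "L.shape = b + e + T"
    by (simp add: L.shape_def e_def assms(3))
  have Gamma_1: "multi_gamma \<beta> 1 x (\<lambda>_. 0) = Gamma x" for x
    by (simp add: multi_gamma_def)
  \<comment> \<open>\<open>riesz1\<close> adds \<open>k\<close> to its parameter; subtracting
    \<open>k\<close> here makes the resulting gamma shape \<open>e + b + T\<close>.\<close>
  have "riesz1 M \<beta> (e + b + T - k) k S"
  proof -
    have "gamma_kernel \<beta> L.shape s / L.Z =
        (if s > 0 then \<beta> powr (e + b + T) / Gamma (e + b + T) * exp (- \<beta> * s) * s powr (e + b + T - 1) else 0)" for s
      by (simp add: gamma_kernel_def L.Z_def shape add_ac)
    then show ?thesis
      using L.distributed_S by (simp only: riesz1_def S diff_add_cancel)
  qed
  moreover have "distributed M lborel R (\<lambda>X. ennreal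
      (if 1 - (norm X)\<^sup>2 > 0 then G * Gamma (e + b + T) / (D * Gamma b)
        * (1 - (norm X)\<^sup>2) powr (b - 1) * q X else 0))"
  proof -
    have "L.Z * (\<beta> powr (e + T) * G / D * \<beta> powr b / Gamma b) = G * Gamma (e + b + T) / (D * Gamma b)"
    proof -
      \<comment> \<open>The power of \<open>\<beta>\<close> in the denominator of \<open>L.Z\<close>
        cancels those from the densities of \<open>S1\<close> and \<open>Y\<close>.\<close>
      have "\<beta> powr L.shape = \<beta> powr (e + T) * \<beta> powr b"
        by (simp add: shape add_ac flip: powr_add)
      then show ?thesis
        using \<beta> by (simp add: L.Z_def shape add_ac)
    qed
    then have "L.Z * L.pearson_kernel X = (if 1 - (norm X)\<^sup>2 > 0 then G * Gamma (e + b + T) / (D * Gamma b)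
        * (1 - (norm X)\<^sup>2) powr (b - 1) * q X else 0)" for X
      unfolding L.pearson_kernel_def by (simp only: mult.assoc[symmetric] if_distrib[of "(*) L.Z"] mult_zero_right)
    then show ?thesis
      using L.distributed_R by (simp only: R)
  qed
  moreover have "(\<nu> + real CARD('m) * real CARD('n)) * \<beta> / 2 + T = e + b + T - k"
    "(\<nu> + real CARD('m) * real CARD('n)) * \<beta> / 2 + k + T = e + b + T"
    "\<beta> * real CARD('m) * real CARD('n) / 2 = e"
    by (simp_all add: e_def b_def algebra_simps add_divide_distrib)
  ultimately show ?thesis
    using L.indep_S_R
    unfolding Gamma_1 mat_norm_eq_norm S R T_def[symmetric] G_def[symmetric] b_def[symmetric]
    by (simp only: D_def q_def)
qed

end
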